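(* Let $\nu,\gamma,\delta,\mu>0$ and $h>0$ satisfy $\nu\ge\frac{\mu c_p^2h^2}{2}$ and $\mu\ge2(\gamma+\nu)$. Given $Y^{n-1}\in S_h$, if $k>0$ is sufficiently small that $$k\Big(\gamma+\frac{\mu c_p^2h^2}{2}\Big)<1,$$ then there exists a solution $Y^n\in S_h$ of the backward Euler scheme $$\left(\frac{Y^n-Y^{n-1}}{k},\chi\right)+\nu(Y^n_x,\chi_x)-\gamma(Y^n,\chi)+\delta((Y^n)^3,\chi)=-\mu(I_h(Y^n),\chi)\qquad\forall\chi\in S_h .$$
   Context: Notation: $(\cdot,\cdot)$ and $\|\cdot\|$ are the inner product and norm of $L^2(0,1)$; $\|v\|_1^2=\|v\|^2+\|v_x\|^2$; $H^1_{\{0\}}(0,1)=\{v\in H^1(0,1): v(0)=0\}$. Interpolation operator: $I_h:H^1(0,1)\to L^2(0,1)$ is linear and satisfies $\|\phi-I_h(\phi)\|\le c_ph\|\phi\|_1$ for all $\phi\in H^1(0,1)$, with $c_p$ independent of $\phi$ and $h$. Finite element space: $0=x_0<x_1<\dots<x_N=1$ is a partition of $(0,1)$ into $I_j=(x_{j-1},x_j)$ of length $h_j$, $h=\max_jh_j$, and $S_h\subset H^1_{\{0\}}(0,1)$ is the space of continuous functions $v_h$ on $[0,1]$ that are polynomials of degree $\le1$ on each $I_j$, with $v_h(0)=0$. *)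

theory Defs
  imports "HOL-Analysis.Analysis" "HOL-Computational_Algebra.Polynomial"
begin

text \<open>
  Elements of \<open>L\<^sup>2(0,1)\<close> and \<open>H\<^sup>1(0,1)\<close> are represented by functions on the real line;
  only their restriction to \<open>(0,1)\<close>, up to null sets, enters the notions below.
\<close>

abbreviation unit_leb :: "real measure" where
  "unit_leb \<equiv> lebesgue_on {0<..<1}"

definition L2 :: "(real \<Rightarrow> real) set" where
  "L2 = {f \<in> borel_measurable unit_leb. integrable unit_leb (\<lambda>s. (f s)\<^sup>2)}"

definition L2_inner :: "(real \<Rightarrow> real) \<Rightarrow> (real \<Rightarrow> real) \<Rightarrow> real" where
  "L2_inner f g = (LINT s|unit_leb. f s * g s)"

definition L2_norm :: "(real \<Rightarrow> real) \<Rightarrow> real" where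
  "L2_norm f = sqrt (L2_inner f f)"

text \<open>
  Weak derivatives are tested against \<open>C\<^sup>1\<close> functions with compact support in \<open>(0,1)\<close>, as in
  Brezis, Functional Analysis, Sobolev Spaces and Partial Differential Equations, Chapter 8.
\<close>

definition test_functions :: "(real \<Rightarrow> real) set" where
  "test_functions = {\<phi>. \<phi> C1_differentiable_on UNIV \<and>
     (\<exists>K. compact K \<and> K \<subseteq> {0<..<1} \<and> (\<forall>s. s \<notin> K \<longrightarrow> \<phi> s = 0))}"

definition has_weak_deriv :: "(real \<Rightarrow> real) \<Rightarrow> (real \<Rightarrow> real) \<Rightarrow> bool" where
  "has_weak_deriv v g \<longleftrightarrow> g \<in> L2 \<and>
     (\<forall>\<phi> \<in> test_functions. L2_inner v (deriv \<phi>) = - L2_inner g \<phi>)"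

definition H1 :: "(real \<Rightarrow> real) set" where
  "H1 = {v \<in> L2. \<exists>g. has_weak_deriv v g}"

text \<open>
  The weak derivative is unique up to null sets, so the choice of a representative does not
  affect the integrals in which it occurs.
\<close>

definition weak_deriv :: "(real \<Rightarrow> real) \<Rightarrow> real \<Rightarrow> real" where
  "weak_deriv v = (SOME g. has_weak_deriv v g)"

definition H1_norm :: "(real \<Rightarrow> real) \<Rightarrow> real" where
  "H1_norm v = sqrt ((L2_norm v)\<^sup>2 + (L2_norm (weak_deriv v))\<^sup>2)"

text \<open>
  Equality in \<open>L\<^sup>2(0,1)\<close> is equality almost everywhere, hence linearity is required almost
  everywhere. Linearity and the error bound force \<open>J\<close> to map almost everywhere equal functions
  to almost everywhere equal functions, so \<open>J\<close> does act on equivalence classes.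
\<close>

definition interpolation_operator ::
    "real \<Rightarrow> real \<Rightarrow> ((real \<Rightarrow> real) \<Rightarrow> (real \<Rightarrow> real)) \<Rightarrow> bool" where
  "interpolation_operator c h J \<longleftrightarrow>
     (\<forall>\<phi> \<in> H1. J \<phi> \<in> L2) \<and>
     (\<forall>\<phi> \<in> H1. \<forall>\<psi> \<in> H1. \<forall>a b.
        AE s in unit_leb. J (\<lambda>t. a * \<phi> t + b * \<psi> t) s = a * J \<phi> s + b * J \<psi> s) \<and>
     (\<forall>\<phi> \<in> H1. L2_norm (\<lambda>s. \<phi> s - J \<phi> s) \<le> c * h * H1_norm \<phi>)"

definition is_partition :: "nat \<Rightarrow> (nat \<Rightarrow> real) \<Rightarrow> bool" where
  "is_partition N x \<longleftrightarrow> x 0 = 0 \<and> x N = 1 \<and> (\<forall>j \<in> {1..N}. x (j - 1) < x j)"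

definition mesh_size :: "nat \<Rightarrow> (nat \<Rightarrow> real) \<Rightarrow> real" where
  "mesh_size N x = Max ((\<lambda>j. x j - x (j - 1)) ` {1..N})"

definition fe_space :: "nat \<Rightarrow> (nat \<Rightarrow> real) \<Rightarrow> (real \<Rightarrow> real) set" where
  "fe_space N x = {v. continuous_on {0..1} v \<and> v 0 = 0 \<and>
     (\<forall>j \<in> {1..N}. \<exists>p :: real poly. degree p \<le> 1 \<and> (\<forall>s \<in> {x (j - 1)<..<x j}. v s = poly p s))}"

end

theory Submission
  imports Defs
begin

text \<open>
  The equation is strongly monotone, so Brouwer's theorem is not needed. For \<open>W = Y - Z\<close> the terms
  of the scheme tested with \<open>W\<close> are bounded below by
  \<open>(1/k - \<gamma> - \<mu> c\<^sub>p\<^sup>2 h\<^sup>2/2 + \<mu>/2) \<parallel>W\<parallel>\<^sup>2\<close>: the cubic term is monotone, and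
  \<open>2 (I\<^sub>h W, W) \<ge> \<parallel>W\<parallel>\<^sup>2 - \<parallel>W - I\<^sub>h W\<parallel>\<^sup>2\<close> controls the feedback term. After replacing the cubic by the
  globally Lipschitz function \<open>clamp(Y)\<^sup>3\<close>, the map \<open>y \<mapsto> y - \<tau> G y\<close> on coordinate vectors is a
  contraction for small \<open>\<tau>\<close>. The a priori bound on \<open>\<parallel>Y\<parallel>\<close> does not depend on the clamping level,
  which can therefore be chosen so large that the solution never reaches it.

  The integrals with \<open>weak_deriv\<close>, a choice of representative, are computed through the
  uniqueness of weak derivatives.
\<close>

section \<open>Zeros of strongly monotone Lipschitz maps\<close>

text \<open>Expanding the square shows that \<open>y - t * G y\<close> contracts the squared
  Euclidean distance by the factor \<open>1 - 2*t*m + t^2*L\<close>, where \<open>L\<close> bounds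
  the squared Lipschitz constant. The distance \<open>D\<close> ignores coordinates outside
  \<open>I\<close>, so it is only a pseudometric on functions, and the Picard iteration is followed
  coordinate by coordinate.\<close>

lemma strongly_monotone_lipschitz_zero:
  fixes G :: "('i \<Rightarrow> real) \<Rightarrow> 'i \<Rightarrow> real"
  assumes fin: "finite I" and m: "m > 0"
    and mono: "\<And>y z. m * (\<Sum>i\<in>I. (y i - z i)\<^sup>2) \<le> (\<Sum>i\<in>I. (G y i - G z i) * (y i - z i))"
    and lip: "\<And>y z i. i \<in> I \<Longrightarrow> \<bar>G y i - G z i\<bar> \<le> C * (\<Sum>j\<in>I. \<bar>y j - z j\<bar>)"
  shows "\<exists>y. \<forall>i\<in>I. G y i = 0"
proof -
  define D where "D y z = (\<Sum>i\<in>I. (y i - z i)\<^sup>2)" for y z :: "'i \<Rightarrow> real"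
  have D_nonneg: "D y z \<ge> 0" for y z
    by (simp add: D_def sum_nonneg)
  \<comment> \<open>The first entry is the squared Euclidean Lipschitz constant obtained from the
    coordinate bounds by Cauchy-Schwarz. The maximum with the square of \<open>m\<close> keeps
    \<open>L\<close> positive and the contraction factor nonnegative, also for empty
    \<open>I\<close> or \<open>C = 0\<close>.\<close>
  define L where "L = max (real (card I) * (C\<^sup>2 * card I)) (m\<^sup>2)"
  have L: "L > 0" "m\<^sup>2 \<le> L"
    using m by (auto simp: L_def less_max_iff_disj)
  have lip2: "(\<Sum>i\<in>I. (G y i - G z i)\<^sup>2) \<le> L * D y z" for y z
  proof -
    have "(G y i - G z i)\<^sup>2 \<le> C\<^sup>2 * card I * D y z" if "i \<in> I" for i
    proof -
      have "(G y i - G z i)\<^sup>2 \<le> (C * (\<Sum>j\<in>I. \<bar>y j - z j\<bar>))\<^sup>2"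
        using lip[OF that, of y z] by (rule abs_le_square_iff[THEN iffD1, OF order_trans[OF _ abs_ge_self]])
      also have "\<dots> \<le> C\<^sup>2 * (D y z * card I)"
        using sum_squared_le_sum_of_squares[of "\<lambda>j. \<bar>y j - z j\<bar>" I]
        by (auto simp: power_mult_distrib D_def intro!: mult_left_mono)
      finally show ?thesis by (simp add: mult_ac)
    qed
    then have "(\<Sum>i\<in>I. (G y i - G z i)\<^sup>2) \<le> card I * (C\<^sup>2 * card I * D y z)"
      by (rule sum_bounded_above)
    also have "\<dots> \<le> L * D y z"
      using D_nonneg[of y z] unfolding L_def mult.assoc[symmetric] by (intro mult_right_mono) auto
    finally show ?thesis .
  qed
  \<comment> \<open>The step size \<open>m / L\<close> minimises the contraction factor; the minimum
    is the \<open>q\<close> below.\<close>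
  define T where "T y = (\<lambda>i. y i - m / L * G y i)" for y
  define q where "q = 1 - m\<^sup>2 / L"
  have q: "0 \<le> q" "q < 1"
    using L m by (auto simp: q_def field_simps)
  have contr: "D (T y) (T z) \<le> q * D y z" for y z
  proof -
    have "D (T y) (T z) = (\<Sum>i\<in>I. (y i - z i)\<^sup>2 - 2 * (m / L) * ((G y i - G z i) * (y i - z i))
        + (m / L)\<^sup>2 * (G y i - G z i)\<^sup>2)"
      unfolding D_def T_def by (intro sum.cong refl) (simp add: power2_eq_square algebra_simps)
    also have "\<dots> = D y z - 2 * (m / L) * (\<Sum>i\<in>I. (G y i - G z i) * (y i - z i))
        + (m / L)\<^sup>2 * (\<Sum>i\<in>I. (G y i - G z i)\<^sup>2)"
      by (simp add: sum.distrib sum_subtractf sum_distrib_left D_def)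
    also have "\<dots> \<le> D y z - 2 * (m / L) * (m * D y z) + (m / L)\<^sup>2 * (L * D y z)"
      using L m lip2[of y z] mono[of y z]
      by (intro add_mono diff_mono mult_left_mono) (auto simp: D_def)
    also have "\<dots> = q * D y z"
      using L by (simp add: q_def field_simps power2_eq_square)
    finally show ?thesis .
  qed
  define u where "u n = (T ^^ n) (\<lambda>_. 0)" for n
  have u_Suc: "u (Suc n) = T (u n)" for n
    by (simp add: u_def)
  have geom: "D (u (Suc n)) (u n) \<le> q ^ n * D (u 1) (u 0)" for n
  proof (induction n)
    case (Suc n)
    have "D (u (Suc (Suc n))) (u (Suc n)) \<le> q * D (u (Suc n)) (u n)"
      using contr[of "u (Suc n)" "u n"] by (simp add: u_Suc)
    also have "\<dots> \<le> q * (q ^ n * D (u 1) (u 0))"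
      using Suc q by (intro mult_left_mono)
    finally show ?case by simp
  qed simp
  have coord: "(y i - z i)\<^sup>2 \<le> D y z" if "i \<in> I" for i y z
    unfolding D_def by (rule member_le_sum[OF that]) (auto simp: fin)
  have "convergent (\<lambda>n. u n i)" if "i \<in> I" for i
  proof -
    have step: "\<bar>u (Suc n) i - u n i\<bar> \<le> sqrt q ^ n * sqrt (D (u 1) (u 0))" for n
    proof -
      have "\<bar>u (Suc n) i - u n i\<bar> = sqrt ((u (Suc n) i - u n i)\<^sup>2)" by simp
      also have "\<dots> \<le> sqrt (q ^ n * D (u 1) (u 0))"
        using order_trans[OF coord[OF that] geom[of n]] by (rule real_sqrt_le_mono)
      finally show ?thesis by (simp add: real_sqrt_mult real_sqrt_power)
    qed
    \<comment> \<open>Geometrically decaying increments form a convergent telescoping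
      series.\<close>
    have "summable (\<lambda>n. u (Suc n) i - u n i)"
    proof (rule summable_comparison_test)
      show "summable (\<lambda>n. sqrt q ^ n * sqrt (D (u 1) (u 0)))"
        using q by (intro summable_mult2 summable_geometric) auto
    qed (use step in auto)
    then have "convergent (\<lambda>n. \<Sum>k<n. u (Suc k) i - u k i)"
      by (simp add: summable_iff_convergent)
    then have "convergent (\<lambda>n. u n i - u 0 i)"
      by (simp add: sum_lessThan_telescope[of "\<lambda>k. u k i"])
    then show ?thesis by (simp add: convergent_diff_const_right_iff)
  qed
  then have "\<forall>i\<in>I. \<exists>l. (\<lambda>n. u n i) \<longlonglongrightarrow> l"
    by (auto simp: convergent_def)
  then obtain y where y: "\<And>i. i \<in> I \<Longrightarrow> (\<lambda>n. u n i) \<longlonglongrightarrow> y i"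
    by metis
  have "G y i = 0" if "i \<in> I" for i
  proof -
    have "(\<lambda>n. D (u n) y) \<longlonglongrightarrow> (\<Sum>i\<in>I. (y i - y i)\<^sup>2)"
      unfolding D_def by (intro tendsto_intros y)
    then have "(\<lambda>n. q * D (u n) y) \<longlonglongrightarrow> 0"
      by (auto intro: tendsto_eq_intros)
    \<comment> \<open>The contraction estimate supplies the continuity of \<open>T\<close> at the
      limit: coordinate \<open>i\<close> of the iterates tends both to \<open>y i\<close> and to
      \<open>T y i\<close>.\<close>
    then have "(\<lambda>n. (u (Suc n) i - T y i)\<^sup>2) \<longlonglongrightarrow> 0"
      by (rule tendsto_sandwich[rotated 3, where f = "\<lambda>_. 0"])
        (use order_trans[OF coord[OF that] contr] in \<open>auto simp: u_Suc\<close>)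
    then have "(\<lambda>n. u (Suc n) i - T y i) \<longlonglongrightarrow> 0"
      by simp
    moreover have "(\<lambda>n. u (Suc n) i - T y i) \<longlonglongrightarrow> y i - T y i"
      by (intro tendsto_intros LIMSEQ_Suc y that)
    ultimately have "y i - T y i = 0"
      using LIMSEQ_unique by blast
    then show ?thesis using L m by (simp add: T_def)
  qed
  then show ?thesis by blast
qed

section \<open>The space \<open>L\<^sup>2(0,1)\<close> and weak derivatives\<close>

lemma finite_measure_unit_leb: "finite_measure unit_leb"
  by (rule finite_measure_lebesgue_on) auto

lemma borel_measurable_unit_leb: "f \<in> borel_measurable borel \<Longrightarrow> f \<in> borel_measurable unit_leb"
  by (intro measurable_restrict_space1 measurable_completion) simp

lemma L2_borel_measurable: "f \<in> L2 \<Longrightarrow> f \<in> borel_measurable unit_leb"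
  by (simp add: L2_def)

lemma L2_bounded:
  assumes "f \<in> borel_measurable unit_leb" and "\<And>s. s \<in> {0<..<1} \<Longrightarrow> \<bar>f s\<bar> \<le> B"
  shows "f \<in> L2"
proof -
  have "integrable unit_leb (\<lambda>s. (f s)\<^sup>2)"
  proof (rule finite_measure.integrable_const_bound[OF finite_measure_unit_leb, where B = "B\<^sup>2"])
    show "AE s in unit_leb. norm ((f s)\<^sup>2) \<le> B\<^sup>2"
      using power_mono[OF assms(2) abs_ge_zero, of _ 2] by (intro AE_I2) auto
  qed (use assms(1) in measurable)
  then show ?thesis using assms(1) by (simp add: L2_def)
qed

lemma L2_continuous_on:
  assumes "continuous_on {0..1} f"
  shows "f \<in> L2"
proof -
  have "bounded (f ` {0..1})"
    using assms by (intro compact_imp_bounded compact_continuous_image) auto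
  then obtain B where "\<And>s. s \<in> {0..1} \<Longrightarrow> \<bar>f s\<bar> \<le> B"
    unfolding bounded_iff by (metis image_eqI real_norm_def)
  moreover have "f \<in> borel_measurable unit_leb"
    using assms by (intro continuous_imp_measurable_on_sets_lebesgue continuous_on_subset[OF assms]) auto
  ultimately show ?thesis by (intro L2_bounded[of f B]) auto
qed

lemma L2_integrable_mult:
  assumes "f \<in> L2" "g \<in> L2"
  shows "integrable unit_leb (\<lambda>s. f s * g s)"
proof (rule Bochner_Integration.integrable_bound)
  show "integrable unit_leb (\<lambda>s. (f s)\<^sup>2 + (g s)\<^sup>2)"
    using assms by (simp add: L2_def)
  have "\<bar>f s * g s\<bar> \<le> (f s)\<^sup>2 + (g s)\<^sup>2" for s
    using sum_squares_bound[of "\<bar>f s\<bar>" "\<bar>g s\<bar>"] mult_nonneg_nonneg[of "\<bar>f s\<bar>" "\<bar>g s\<bar>"]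
    unfolding abs_mult power2_abs by linarith
  then show "AE s in unit_leb. norm (f s * g s) \<le> norm ((f s)\<^sup>2 + (g s)\<^sup>2)"
    by (intro AE_I2) (auto intro: order_trans)
qed (use assms in \<open>auto simp: L2_def\<close>)

lemma L2_add:
  assumes "f \<in> L2" "g \<in> L2"
  shows "(\<lambda>s. f s + g s) \<in> L2"
proof -
  have "integrable unit_leb (\<lambda>s. (f s)\<^sup>2 + (g s)\<^sup>2 + 2 * (f s * g s))"
    using assms L2_integrable_mult[OF assms] by (simp add: L2_def)
  moreover have "(\<lambda>s. f s + g s) \<in> borel_measurable unit_leb"
    using assms by (intro borel_measurable_add L2_borel_measurable)
  ultimately show ?thesis
    by (simp add: L2_def power2_sum mult_ac)
qed

lemma L2_scale: "f \<in> L2 \<Longrightarrow> (\<lambda>s. a * f s) \<in> L2"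
  using borel_measurable_times[of "\<lambda>_. a" unit_leb f] by (simp add: L2_def power_mult_distrib)

lemma L2_diff: "f \<in> L2 \<Longrightarrow> g \<in> L2 \<Longrightarrow> (\<lambda>s. f s - g s) \<in> L2"
  using L2_add[of f "\<lambda>s. -1 * g s"] L2_scale[of g "-1"] by simp

lemma L2_divide: "f \<in> L2 \<Longrightarrow> (\<lambda>s. f s / a) \<in> L2"
  using L2_scale[of f "inverse a"] by (simp add: field_simps)

lemma L2_sum: "(\<And>i. i \<in> A \<Longrightarrow> f i \<in> L2) \<Longrightarrow> (\<lambda>s. \<Sum>i\<in>A. f i s) \<in> L2"
proof (induction A rule: infinite_finite_induct)
  case (insert a A)
  then show ?case using L2_add[of "f a" "\<lambda>s. \<Sum>i\<in>A. f i s"] by simp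
qed (auto simp: L2_def)

lemma L2_inner_commute: "L2_inner f g = L2_inner g f"
  by (simp add: L2_inner_def mult.commute)

lemma L2_inner_add:
  "f \<in> L2 \<Longrightarrow> g \<in> L2 \<Longrightarrow> w \<in> L2 \<Longrightarrow> L2_inner (\<lambda>s. f s + g s) w = L2_inner f w + L2_inner g w"
  by (simp add: L2_inner_def distrib_right L2_integrable_mult)

lemma L2_inner_diff:
  "f \<in> L2 \<Longrightarrow> g \<in> L2 \<Longrightarrow> w \<in> L2 \<Longrightarrow> L2_inner (\<lambda>s. f s - g s) w = L2_inner f w - L2_inner g w"
  by (simp add: L2_inner_def left_diff_distrib L2_integrable_mult)

lemma L2_inner_scale: "L2_inner (\<lambda>s. a * f s) w = a * L2_inner f w"
  by (simp add: L2_inner_def mult.assoc)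

lemma L2_inner_divide: "L2_inner (\<lambda>s. f s / a) w = L2_inner f w / a"
  by (simp add: L2_inner_def)

lemma L2_inner_sum:
  assumes "\<And>i. i \<in> A \<Longrightarrow> f i \<in> L2" "w \<in> L2"
  shows "L2_inner (\<lambda>s. \<Sum>i\<in>A. a i * f i s) w = (\<Sum>i\<in>A. a i * L2_inner (f i) w)"
  unfolding L2_inner_def sum_distrib_right
  using assms by (subst Bochner_Integration.integral_sum)
    (auto simp: mult.assoc intro!: L2_integrable_mult)

lemma L2_inner_cong_AE:
  assumes "f \<in> borel_measurable unit_leb" "f' \<in> borel_measurable unit_leb"
    "g \<in> borel_measurable unit_leb" "g' \<in> borel_measurable unit_leb"
    and "AE s in unit_leb. f s = f' s" "AE s in unit_leb. g s = g' s"
  shows "L2_inner f g = L2_inner f' g'"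
  unfolding L2_inner_def
  by (rule integral_cong_AE) (use assms in auto)

lemma L2_inner_cong:
  assumes "\<And>s. s \<in> {0<..<1} \<Longrightarrow> f s = f' s" "\<And>s. s \<in> {0<..<1} \<Longrightarrow> g s = g' s"
  shows "L2_inner f g = L2_inner f' g'"
  unfolding L2_inner_def
  by (rule Bochner_Integration.integral_cong) (use assms in auto)

lemma L2_inner_nonneg: "L2_inner f f \<ge> 0"
  by (simp add: L2_inner_def)

lemma L2_norm_power2: "(L2_norm f)\<^sup>2 = L2_inner f f"
  by (simp add: L2_norm_def L2_inner_nonneg)

text \<open>Expansion of the square of \<open>f - g\<close>. This form serves both the feedback term
  and the a priori bound.\<close>

lemma L2_inner_young:
  assumes f: "f \<in> L2" and g: "g \<in> L2"
  shows "2 * L2_inner f g \<le> L2_inner f f + L2_inner g g"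
proof -
  have "0 \<le> L2_inner (\<lambda>s. f s - g s) (\<lambda>s. f s - g s)"
    by (rule L2_inner_nonneg)
  also have "\<dots> = L2_inner f f - 2 * L2_inner f g + L2_inner g g"
    using L2_inner_diff[OF f g L2_diff[OF f g]] L2_inner_diff[OF f g f] L2_inner_diff[OF f g g]
      L2_inner_commute[of f "\<lambda>s. f s - g s"] L2_inner_commute[of g "\<lambda>s. f s - g s"]
      L2_inner_commute[of g f]
    by linarith
  finally show ?thesis by simp
qed

lemma L2_integrable: "f \<in> L2 \<Longrightarrow> integrable unit_leb f"
  using L2_integrable_mult[of f "\<lambda>_. 1"] L2_bounded[of "\<lambda>_. 1" 1] by simp

section \<open>Fundamental lemma of the calculus of variations and uniqueness of weak
  derivatives\<close>

text \<open>The positive and negative parts of \<open>f\<close> are densities of two finite measures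
  that agree on all half-lines, hence everywhere. Densities are unique up to null sets, so the two
  parts coincide almost everywhere, which forces both to vanish there.\<close>

lemma integral_tails_zero_imp_AE_zero:
  fixes f :: "real \<Rightarrow> real"
  assumes f: "integrable lborel f"
    and tails: "\<And>t. (LINT s|lborel. f s * indicator {t<..} s) = 0"
  shows "AE s in lborel. f s = 0"
proof -
  note [measurable] = borel_measurable_integrable[OF f]
  define p where "p s = max 0 (f s)" for s
  define n where "n s = max 0 (- f s)" for s
  have [measurable]: "p \<in> borel_measurable lborel" "n \<in> borel_measurable lborel"
    by (simp_all add: p_def[abs_def] n_def[abs_def])
  have ip: "integrable lborel (\<lambda>s. p s * indicator {t<..} s)"
    and iN: "integrable lborel (\<lambda>s. n s * indicator {t<..} s)" for t
    by (rule Bochner_Integration.integrable_bound[OF f];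
        auto simp: p_def n_def indicator_def intro!: AE_I2)+
  have em: "emeasure (density lborel (\<lambda>s. ennreal (g s))) {t<..}
      = ennreal (LINT s|lborel. g s * indicator {t<..} s)"
    if "integrable lborel (\<lambda>s. g s * indicator {t<..} s)" "\<And>s. g s \<ge> 0"
      "g \<in> borel_measurable lborel" for g :: "real \<Rightarrow> real" and t
  proof -
    have "emeasure (density lborel (\<lambda>s. ennreal (g s))) {t<..}
        = (\<integral>\<^sup>+ s. ennreal (g s * indicator {t<..} s) \<partial>lborel)"
      using that by (subst emeasure_density)
        (auto intro!: nn_integral_cong split: split_indicator)
    also have "\<dots> = ennreal (LINT s|lborel. g s * indicator {t<..} s)"
      using that by (intro nn_integral_eq_integral) (auto split: split_indicator)
    finally show ?thesis .
  qed
  have "density lborel (\<lambda>s. ennreal (p s)) = density lborel (\<lambda>s. ennreal (n s))"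
  proof (rule measure_eqI_lessThan)
    fix t
    have "(LINT s|lborel. p s * indicator {t<..} s) - (LINT s|lborel. n s * indicator {t<..} s)
        = (LINT s|lborel. p s * indicator {t<..} s - n s * indicator {t<..} s)"
      using ip iN by simp
    also have "\<dots> = (LINT s|lborel. f s * indicator {t<..} s)"
      by (intro Bochner_Integration.integral_cong)
        (auto simp: p_def n_def max_def split: split_indicator)
    finally have "(LINT s|lborel. p s * indicator {t<..} s) - (LINT s|lborel. n s * indicator {t<..} s)
        = (LINT s|lborel. f s * indicator {t<..} s)" .
    then show "emeasure (density lborel (\<lambda>s. ennreal (p s))) {t<..}
        = emeasure (density lborel (\<lambda>s. ennreal (n s))) {t<..}"
      using tails[of t] ip iN by (simp add: em p_def n_def)
    show "emeasure (density lborel (\<lambda>s. ennreal (p s))) {t<..} < \<infinity>"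
      using ip by (simp add: em p_def)
  qed auto
  then have "AE s in lborel. ennreal (p s) = ennreal (n s)"
    by (intro sigma_finite_measure.density_unique[OF sigma_finite_lborel]) auto
  then show ?thesis
    by eventually_elim (auto simp: p_def n_def max_def split: if_splits)
qed


text \<open>
  As \<open>n\<close> tends to infinity, these \<open>C\<^sup>1\<close> functions converge pointwise to the indicator of \<open>(a, b)\<close>.
\<close>

definition cutoff :: "real \<Rightarrow> real \<Rightarrow> real \<Rightarrow> real \<Rightarrow> real" where
  "cutoff n a b s = 1 - 1 / (1 + n * (max 0 ((s - a) * (b - s)))\<^sup>2)"

text \<open>Squaring removes the kink of the positive part, which is why \<open>cutoff\<close>
  contains a square. Only \<open>t = 0\<close> is delicate; there the difference quotient is bounded
  by the absolute value of the increment.\<close>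

lemma has_real_derivative_max_0_power2:
  "((\<lambda>t::real. (max 0 t)\<^sup>2) has_real_derivative 2 * max 0 t) (at t)"
proof -
  consider "t < 0" | "t = 0" | "t > 0" by linarith
  then show ?thesis
  proof cases
    case 1
    have "((\<lambda>t::real. 0) has_real_derivative 2 * max 0 t) (at t)"
      using 1 by (auto intro!: derivative_eq_intros)
    then show ?thesis
      by (rule has_field_derivative_transform_within_open[of _ _ _ "{..<0}"]) (use 1 in auto)
  next
    case 2
    have "(\<lambda>h::real. ((max 0 (0 + h))\<^sup>2 - (max 0 0)\<^sup>2) / h) \<midarrow>0\<rightarrow> 0"
    proof (rule Lim_null_comparison[where g = "\<lambda>h. \<bar>h\<bar>"])
      show "\<forall>\<^sub>F h in at 0. norm (((max 0 (0 + h))\<^sup>2 - (max 0 0)\<^sup>2) / h) \<le> \<bar>h\<bar>"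
        by (intro always_eventually) (auto simp: max_def power2_eq_square)
      show "(\<lambda>h::real. \<bar>h\<bar>) \<midarrow>0\<rightarrow> 0"
        by (intro tendsto_rabs_zero tendsto_ident_at)
    qed
    then show ?thesis using 2 by (simp add: DERIV_def)
  next
    case 3
    have "((\<lambda>t::real. t\<^sup>2) has_real_derivative 2 * max 0 t) (at t)"
      using 3 by (auto intro!: derivative_eq_intros)
    then show ?thesis
      by (rule has_field_derivative_transform_within_open[of _ _ _ "{0<..}"]) (use 3 in auto)
  qed
qed

text \<open>The quadratic \<open>(s - a) * (b - s)\<close> is positive exactly between
  \<open>a\<close> and \<open>b\<close>, so the support lies in a compact subinterval of the open
  unit interval. The denominator is at least 1, so differentiability is inherited from the squared
  positive part.\<close>

lemma cutoff_test_function: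
  assumes "0 < a" "a < b" "b < 1" "n \<ge> 0"
  shows "cutoff n a b \<in> test_functions"
proof -
  define q where "q s = (s - a) * (b - s)" for s
  have pos: "1 + n * (max 0 (q s))\<^sup>2 > 0" for s
    using assms by (intro add_pos_nonneg) auto
  define D where "D s = n * (2 * max 0 (q s) * (a + b - 2 * s)) / (1 + n * (max 0 (q s))\<^sup>2)\<^sup>2" for s
  have q_deriv: "((\<lambda>s. (max 0 (q s))\<^sup>2) has_real_derivative 2 * max 0 (q s) * (a + b - 2 * s)) (at s)" for s
    by (rule DERIV_chain2[OF has_real_derivative_max_0_power2])
      (auto simp: q_def[abs_def] algebra_simps intro!: derivative_eq_intros)
  have "(cutoff n a b has_real_derivative D s) (at s)" for s
    unfolding cutoff_def[abs_def] q_def[symmetric] D_def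
    by (rule DERIV_cong[OF DERIV_diff[OF DERIV_const
          DERIV_divide[OF DERIV_const DERIV_add[OF DERIV_const DERIV_cmult[OF q_deriv]]]]])
      (use pos[of s] in \<open>simp_all add: power2_eq_square\<close>)
  moreover have "continuous_on UNIV D"
    unfolding D_def q_def using pos[unfolded q_def]
    by (intro continuous_intros) (auto simp: less_le)
  ultimately have "cutoff n a b C1_differentiable_on UNIV"
    unfolding C1_differentiable_on_def by (auto simp: has_real_derivative_iff_has_vector_derivative)
  moreover have "cutoff n a b s = 0" if "s \<notin> {a..b}" for s
    using that assms by (auto simp: cutoff_def max_def mult_less_0_iff zero_le_mult_iff)
  ultimately show ?thesis
    unfolding test_functions_def using assms by (auto intro!: exI[of _ "{a..b}"])
qed

lemma cutoff_bounds: "n \<ge> 0 \<Longrightarrow> 0 \<le> cutoff n a b s" "n \<ge> 0 \<Longrightarrow> cutoff n a b s \<le> 1"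
  by (simp_all add: cutoff_def divide_le_eq_1 add_pos_nonneg)

lemma test_function_L2: "\<phi> \<in> test_functions \<Longrightarrow> \<phi> \<in> L2"
  unfolding test_functions_def
  by (auto intro!: L2_continuous_on intro: continuous_on_subset C1_differentiable_imp_continuous_on)

text \<open>Cutoffs approximate the indicator of the part of the interval to the right of
  \<open>t\<close>; dominated convergence turns orthogonality into vanishing tail integrals, and
  these determine \<open>d\<close> almost everywhere.\<close>

lemma orthogonal_test_functions_imp_AE_zero:
  assumes d: "d \<in> L2" and orth: "\<And>\<phi>. \<phi> \<in> test_functions \<Longrightarrow> L2_inner d \<phi> = 0"
  shows "AE s in unit_leb. d s = 0"
proof -
  have id: "integrable unit_leb d"
    using d by (rule L2_integrable)
  have tails: "(LINT s|unit_leb. d s * indicator {t<..} s) = 0" for t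
  proof (cases "t < 1")
    case False
    then have "(LINT s|unit_leb. d s * indicator {t<..} s) = (LINT s|unit_leb. 0)"
      by (intro Bochner_Integration.integral_cong) auto
    then show ?thesis by simp
  next
    case True
    define a where "a = max 0 t"
    have a: "0 \<le> a" "a < 1" using True by (auto simp: a_def)
    \<comment> \<open>The shift \<open>n + 3\<close> makes \<open>e n\<close> at most a third of
      \<open>1 - a\<close>, so the endpoints \<open>a + e n\<close> and \<open>1 - e n\<close> stay
      ordered and strictly inside the unit interval, while they converge to \<open>a\<close> and
      1.\<close>
    define e where "e n = (1 - a) / real (n + 3)" for n
    have e: "0 < e n" "e n < (1 - a) / 2" for n
      unfolding e_def using a by (simp, intro divide_strict_left_mono) auto
    have e_lim: "e \<longlonglongrightarrow> 0"
      unfolding e_def using LIMSEQ_ignore_initial_segment[OF lim_const_over_n, of "1 - a" 3] by simp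
    define \<phi> where "\<phi> n = cutoff (real n) (a + e n) (1 - e n)" for n
    have \<phi>_test: "\<phi> n \<in> test_functions" for n
      unfolding \<phi>_def using a e[of n] by (intro cutoff_test_function) auto
    have "(\<lambda>n. LINT s|unit_leb. d s * \<phi> n s) \<longlonglongrightarrow> (LINT s|unit_leb. d s * indicator {t<..} s)"
    proof (rule integral_dominated_convergence)
      show "(\<lambda>s. d s * \<phi> n s) \<in> borel_measurable unit_leb" for n
        by (intro borel_measurable_times L2_borel_measurable d test_function_L2 \<phi>_test)
      show "integrable unit_leb (\<lambda>s. \<bar>d s\<bar>)"
        using id by simp
      show "(\<lambda>s. d s * indicator {t<..} s) \<in> borel_measurable unit_leb"
        by (intro borel_measurable_times L2_borel_measurable d borel_measurable_unit_leb) simp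
      show "AE s in unit_leb. norm (d s * \<phi> n s) \<le> \<bar>d s\<bar>" for n
        using cutoff_bounds[of "real n"] by (intro AE_I2) (auto simp: abs_mult \<phi>_def intro!: mult_left_le)
      show "AE s in unit_leb. (\<lambda>n. d s * \<phi> n s) \<longlonglongrightarrow> d s * indicator {t<..} s"
      proof (intro AE_I2 tendsto_mult tendsto_const)
        fix s assume "s \<in> space unit_leb"
        then have s: "0 < s" "s < 1" by auto
        define r where "r n = (s - (a + e n)) * (1 - e n - s)" for n
        show "(\<lambda>n. \<phi> n s) \<longlonglongrightarrow> indicator {t<..} s"
        proof (cases "t < s")
          case False
          then have "s \<le> a" by (simp add: a_def)
          then have "r n \<le> 0" for n
            using e[of n] a unfolding r_def by (intro mult_nonpos_nonneg) auto
          then show ?thesis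
            using False by (simp add: \<phi>_def cutoff_def r_def[symmetric] max_absorb1)
        next
          case True
          then have "s > a" using s by (simp add: a_def)
          have "r \<longlonglongrightarrow> (s - (a + 0)) * (1 - 0 - s)"
            unfolding r_def by (intro tendsto_intros e_lim)
          then have "(\<lambda>n. (max 0 (r n))\<^sup>2) \<longlonglongrightarrow> (max 0 ((s - (a + 0)) * (1 - 0 - s)))\<^sup>2"
            by (intro tendsto_intros)
          moreover have "(max 0 ((s - (a + 0)) * (1 - 0 - s)))\<^sup>2 > 0"
            using \<open>s > a\<close> s by (simp add: max_def)
          ultimately have "filterlim (\<lambda>n. (max 0 (r n))\<^sup>2 * real n) at_top sequentially"
            by (rule filterlim_tendsto_pos_mult_at_top) (rule filterlim_real_sequentially)
          then have "filterlim (\<lambda>n. 1 + real n * (max 0 (r n))\<^sup>2) at_top sequentially"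
            by (intro filterlim_tendsto_add_at_top[OF tendsto_const]) (simp add: mult.commute)
          then have "(\<lambda>n. 1 - 1 / (1 + real n * (max 0 (r n))\<^sup>2)) \<longlonglongrightarrow> 1 - 0"
            by (intro tendsto_diff tendsto_const tendsto_divide_0[OF tendsto_const]
                filterlim_at_top_imp_at_infinity)
          then show ?thesis
            using True by (simp add: \<phi>_def cutoff_def r_def[symmetric])
        qed
      qed
    qed
    then show ?thesis
      using orth[OF \<phi>_test] by (simp add: L2_inner_def LIMSEQ_const_iff)
  qed
  \<comment> \<open>Extension by zero followed by the choice of a Borel representative
    \<open>g\<close> passes from Lebesgue measure on the interval to \<open>lborel\<close>, where
    the half-line argument applies.\<close>
  define f where "f s = indicator {0<..<1} s *\<^sub>R d s" for s :: real
  have f: "integrable lebesgue f"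
    using id unfolding f_def by (subst (asm) integrable_restrict_space) auto
  then obtain g where g[measurable]: "g \<in> borel_measurable lborel" and fg: "AE s in lborel. f s = g s"
    using completion_ex_borel_measurable_real[OF borel_measurable_integrable] by blast
  note fg' = AE_completion[OF fg]
  have g': "g \<in> borel_measurable lebesgue"
    using g by (rule measurable_completion)
  have "integrable lebesgue g"
    using integrable_cong_AE[OF borel_measurable_integrable[OF f] g' fg'] f by simp
  then have "integrable lborel g"
    using g by (simp add: integrable_completion)
  moreover have "(LINT s|lborel. g s * indicator {t<..} s) = 0" for t
  proof -
    have "(LINT s|lborel. g s * indicator {t<..} s) = (LINT s|lebesgue. g s * indicator {t<..} s)"
      by (rule integral_completion[symmetric]) measurable
    also have "\<dots> = (LINT s|lebesgue. f s * indicator {t<..} s)"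
    proof (rule integral_cong_AE)
      have ind: "(indicator {t<..} :: real \<Rightarrow> real) \<in> borel_measurable lebesgue"
        by (rule measurable_completion) simp
      show "(\<lambda>s. g s * indicator {t<..} s) \<in> borel_measurable lebesgue"
        by (rule borel_measurable_times[OF g' ind])
      show "(\<lambda>s. f s * indicator {t<..} s) \<in> borel_measurable lebesgue"
        by (rule borel_measurable_times[OF borel_measurable_integrable[OF f] ind])
    qed (use fg' in auto)
    also have "\<dots> = (LINT s|unit_leb. d s * indicator {t<..} s)"
      unfolding f_def by (subst integral_restrict_space) (auto simp: mult.assoc)
    finally show ?thesis by (simp add: tails)
  qed
  ultimately have "AE s in lborel. g s = 0"
    by (rule integral_tails_zero_imp_AE_zero)
  with fg have "AE s in lborel. f s = 0"
    by eventually_elim simp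
  then have "AE s in lebesgue. f s = 0"
    by (rule AE_completion)
  then show ?thesis
    by (subst AE_restrict_space_iff) (auto simp: f_def elim!: eventually_mono)
qed

lemma has_weak_deriv_unique:
  assumes "has_weak_deriv v f" "has_weak_deriv v g"
  shows "AE s in unit_leb. f s = g s"
proof -
  have L2: "f \<in> L2" "g \<in> L2" using assms by (auto simp: has_weak_deriv_def)
  have "AE s in unit_leb. f s - g s = 0"
    using assms L2 by (intro orthogonal_test_functions_imp_AE_zero L2_diff)
      (auto simp: L2_inner_diff test_function_L2 has_weak_deriv_def)
  then show ?thesis by simp
qed

text \<open>This removes the arbitrary choice in \<open>weak_deriv\<close>: under an integral it may
  be replaced by any weak derivative known explicitly.\<close>

lemma weak_deriv_AE_eq:
  assumes "has_weak_deriv v g"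
  shows "weak_deriv v \<in> L2" "AE s in unit_leb. weak_deriv v s = g s"
proof -
  have "has_weak_deriv v (weak_deriv v)"
    unfolding weak_deriv_def using assms by (rule someI[of "has_weak_deriv v"])
  then show "weak_deriv v \<in> L2" "AE s in unit_leb. weak_deriv v s = g s"
    using has_weak_deriv_unique[OF _ assms] by (simp_all only: has_weak_deriv_def)
qed

lemma deriv_test_function:
  assumes "\<phi> \<in> test_functions"
  shows "(\<phi> has_real_derivative deriv \<phi> s) (at s)" and "deriv \<phi> \<in> L2"
proof -
  from assms obtain D where D: "\<And>s. (\<phi> has_vector_derivative D s) (at s)" "continuous_on UNIV D"
    by (auto simp: test_functions_def C1_differentiable_on_def)
  then have D': "(\<phi> has_real_derivative D s) (at s)" for s
    by (simp add: has_real_derivative_iff_has_vector_derivative)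
  then have "deriv \<phi> = D"
    by (auto simp: DERIV_imp_deriv)
  then show "(\<phi> has_real_derivative deriv \<phi> s) (at s)" "deriv \<phi> \<in> L2"
    using D' D(2) by (auto intro: L2_continuous_on continuous_on_subset)
qed

lemma test_function_boundary: "\<phi> \<in> test_functions \<Longrightarrow> \<phi> 0 = 0" "\<phi> \<in> test_functions \<Longrightarrow> \<phi> 1 = 0"
  by (force simp: test_functions_def)+

section \<open>Linear structure of H1(0,1)\<close>

lemma has_weak_deriv_lincomb:
  assumes "v \<in> L2" "w \<in> L2" "has_weak_deriv v f" "has_weak_deriv w g"
  shows "has_weak_deriv (\<lambda>t. a * v t + b * w t) (\<lambda>t. a * f t + b * g t)"
  using assms unfolding has_weak_deriv_def
  by (auto simp: L2_inner_add L2_inner_scale L2_add L2_scale deriv_test_function test_function_L2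
      algebra_simps)

lemma H1_lincomb: "v \<in> H1 \<Longrightarrow> w \<in> H1 \<Longrightarrow> (\<lambda>t. a * v t + b * w t) \<in> H1"
  unfolding H1_def by (auto intro!: L2_add L2_scale dest: has_weak_deriv_lincomb)

lemma H1_zero: "(\<lambda>_. 0) \<in> H1"
proof -
  have "(\<lambda>_. 0) \<in> L2" by (simp add: L2_def)
  moreover from this have "has_weak_deriv (\<lambda>_. 0) (\<lambda>_. 0)"
    by (simp add: has_weak_deriv_def L2_inner_def)
  ultimately show ?thesis by (auto simp: H1_def)
qed

lemma H1_L2: "v \<in> H1 \<Longrightarrow> v \<in> L2"
  by (simp add: H1_def)

lemma H1_sum:
  assumes "\<And>i. i \<in> A \<Longrightarrow> f i \<in> H1"
  shows "(\<lambda>t. \<Sum>i\<in>A. a i * f i t) \<in> H1"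
  using assms
proof (induction A rule: infinite_finite_induct)
  case (insert i A)
  then show ?case using H1_lincomb[of "f i" "\<lambda>t. \<Sum>i\<in>A. a i * f i t" "a i" 1] by simp
qed (auto simp: H1_zero)

section \<open>The interpolation operator and its feedback term\<close>

context
  fixes c h :: real and J :: "(real \<Rightarrow> real) \<Rightarrow> real \<Rightarrow> real"
  assumes J: "interpolation_operator c h J"
begin

lemma interpolation_L2: "v \<in> H1 \<Longrightarrow> J v \<in> L2"
  using J by (simp add: interpolation_operator_def)

text \<open>Linearity of \<open>J\<close> holds only almost everywhere; under the inner product it
  becomes an exact identity.\<close>

lemma L2_inner_interpolation_lincomb:
  assumes v: "v \<in> H1" and w: "w \<in> H1" and g: "g \<in> L2"
  shows "L2_inner (J (\<lambda>t. a * v t + b * w t)) g = a * L2_inner (J v) g + b * L2_inner (J w) g"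
proof -
  note JL = interpolation_L2[OF v] interpolation_L2[OF w]
  have "L2_inner (J (\<lambda>t. a * v t + b * w t)) g = L2_inner (\<lambda>s. a * J v s + b * J w s) g"
  proof (rule L2_inner_cong_AE)
    show "AE s in unit_leb. J (\<lambda>t. a * v t + b * w t) s = a * J v s + b * J w s"
      using J v w by (simp add: interpolation_operator_def)
  qed (use JL v w g in \<open>auto intro!: L2_borel_measurable L2_add L2_scale interpolation_L2 H1_lincomb\<close>)
  also have "\<dots> = a * L2_inner (J v) g + b * L2_inner (J w) g"
    using JL g by (simp add: L2_inner_add L2_scale L2_inner_scale)
  finally show ?thesis .
qed

lemma L2_inner_interpolation_sum:
  assumes "finite A" and "\<And>i. i \<in> A \<Longrightarrow> f i \<in> H1" and g: "g \<in> L2"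
  shows "L2_inner (J (\<lambda>t. \<Sum>i\<in>A. a i * f i t)) g = (\<Sum>i\<in>A. a i * L2_inner (J (f i)) g)"
  using assms(1,2)
proof induction
  case empty
  then show ?case
    \<comment> \<open>The image of the zero function is zero only almost everywhere; taking both
      coefficients 0 shows that its inner products vanish.\<close>
    using L2_inner_interpolation_lincomb[OF H1_zero H1_zero g, of 0 0] by simp
next
  case (insert i A)
  then show ?case
    using L2_inner_interpolation_lincomb[of "f i" "\<lambda>t. \<Sum>i\<in>A. a i * f i t" g "a i" 1] H1_sum[of A f a] g
    by simp
qed

text \<open>Write \<open>2 (J v, v)\<close> as \<open>2 (v, v) - 2 (v - J v, v)\<close> and apply
  Young's inequality to the last term. The error bound then charges the loss to the full H1 norm,
  leaving a derivative term for the diffusion to absorb.\<close>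

lemma interpolation_coercive:
  assumes v: "v \<in> H1"
  shows "(L2_norm v)\<^sup>2 - c\<^sup>2 * h\<^sup>2 * ((L2_norm v)\<^sup>2 + (L2_norm (weak_deriv v))\<^sup>2) \<le> 2 * L2_inner (J v) v"
proof -
  have v2: "v \<in> L2" and Jv: "J v \<in> L2"
    using v by (auto intro: H1_L2 interpolation_L2)
  have "L2_norm (\<lambda>s. v s - J v s) \<le> c * h * H1_norm v"
    using J v by (simp add: interpolation_operator_def)
  then have "(L2_norm (\<lambda>s. v s - J v s))\<^sup>2 \<le> (c * h * H1_norm v)\<^sup>2"
    by (intro power_mono) (auto simp: L2_norm_def L2_inner_nonneg)
  also have "\<dots> = c\<^sup>2 * h\<^sup>2 * ((L2_norm v)\<^sup>2 + (L2_norm (weak_deriv v))\<^sup>2)"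
    by (simp add: power_mult_distrib H1_norm_def)
  finally have "L2_inner (\<lambda>s. v s - J v s) (\<lambda>s. v s - J v s) \<le> \<dots>"
    by (simp add: L2_norm_power2)
  moreover have "2 * L2_inner (\<lambda>s. v s - J v s) v
      \<le> L2_inner (\<lambda>s. v s - J v s) (\<lambda>s. v s - J v s) + L2_inner v v"
    by (rule L2_inner_young[OF L2_diff[OF v2 Jv] v2])
  moreover have "L2_inner (\<lambda>s. v s - J v s) v = L2_inner v v - L2_inner (J v) v"
    by (rule L2_inner_diff[OF v2 Jv v2])
  ultimately show ?thesis
    by (simp add: L2_norm_power2)
qed

end

section \<open>Continuous piecewise linear functions\<close>

locale mesh =
  fixes N :: nat and x :: "nat \<Rightarrow> real"
  assumes partition: "is_partition N x"
begin

abbreviation cell :: "nat \<Rightarrow> real set" where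
  "cell j \<equiv> {x (j - 1)<..<x j}"

text \<open>
  The finite element functions are parametrised by their slopes \<open>y j\<close> on the cells, not by nodal
  values: \<open>ramp j\<close> has slope 1 on cell \<open>j\<close> and slope 0 elsewhere.
\<close>

definition ramp :: "nat \<Rightarrow> real \<Rightarrow> real" where
  "ramp j s = min (max (s - x (j - 1)) 0) (x j - x (j - 1))"

text \<open>Slopes as coordinates build in the boundary value 0 at the left end and let a function
  and its derivative \<open>pc y\<close> share one coefficient vector.\<close>

definition pl :: "(nat \<Rightarrow> real) \<Rightarrow> real \<Rightarrow> real" where
  "pl y s = (\<Sum>j\<in>{1..N}. y j * ramp j s)"

definition pc :: "(nat \<Rightarrow> real) \<Rightarrow> real \<Rightarrow> real" where
  "pc y s = (\<Sum>j\<in>{1..N}. y j * indicator (cell j) s)"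

section \<open>Slope coordinates on the mesh\<close>

lemma x_0: "x 0 = 0" and x_N: "x N = 1" and x_step: "j \<in> {1..N} \<Longrightarrow> x (j - 1) < x j"
  using partition by (auto simp: is_partition_def)

lemma x_mono: "i \<le> j \<Longrightarrow> j \<le> N \<Longrightarrow> x i \<le> x j"
proof (induction j rule: dec_induct)
  case (step n)
  then show ?case using x_step[of "Suc n"] by simp
qed simp

lemma x_range: "j \<le> N \<Longrightarrow> 0 \<le> x j" "j \<le> N \<Longrightarrow> x j \<le> 1"
  using x_mono[of 0 j] x_mono[of j N] by (simp_all add: x_0 x_N)

text \<open>The right end of the cell is the first node beyond \<open>s\<close>; minimality bounds
  \<open>s\<close> from the left, strictly because \<open>s\<close> is not a node.\<close>

lemma cell_cover:
  assumes "s \<in> {0..1}" "s \<notin> x ` {..N}"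
  shows "\<exists>j\<in>{1..N}. s \<in> cell j"
proof -
  have "x N \<noteq> s" using assms(2) by auto
  then have N: "s < x N" using assms(1) x_N by auto
  define j where "j = (LEAST j. s < x j)"
  have j: "s < x j" unfolding j_def using N by (rule LeastI)
  have "j \<le> N" unfolding j_def using N by (rule Least_le)
  moreover have "j \<noteq> 0" using j assms(1) x_0 by (metis atLeastAtMost_iff not_le)
  moreover from this have "\<not> s < x (j - 1)"
    using not_less_Least[of "j - 1" "\<lambda>j. s < x j"] unfolding j_def[symmetric] by simp
  moreover have "x (j - 1) \<noteq> s" using assms(2) \<open>j \<le> N\<close> by auto
  ultimately show ?thesis using j by (intro bexI[of _ j]) auto
qed

text \<open>On cell \<open>j\<close> the earlier ramps are saturated and the later ones still
  vanish, so only \<open>ramp j\<close> varies.\<close>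

lemma pl_on_cell:
  assumes j: "j \<in> {1..N}" and s: "s \<in> {x (j - 1)..x j}"
  shows "pl y s = pl y (x (j - 1)) + y j * (s - x (j - 1))"
proof -
  have "ramp i s - ramp i (x (j - 1)) = (if i = j then s - x (j - 1) else 0)" if i: "i \<in> {1..N}" for i
  proof (cases i j rule: linorder_cases)
    case less
    then have "x i \<le> x (j - 1)" using j by (intro x_mono) auto
    then show ?thesis using less s x_step[OF i] by (simp add: ramp_def)
  next
    case equal
    then show ?thesis using s x_step[OF j] by (simp add: ramp_def)
  next
    case greater
    then have "x j \<le> x (i - 1)" using i by (intro x_mono) auto
    then show ?thesis using greater s x_step[OF i] by (simp add: ramp_def)
  qed
  then have "pl y s - pl y (x (j - 1)) = (\<Sum>i\<in>{1..N}. y i * (if i = j then s - x (j - 1) else 0))"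
    unfolding pl_def sum_subtractf[symmetric] right_diff_distrib[symmetric] by (intro sum.cong) auto
  also have "\<dots> = y j * (s - x (j - 1))"
    using j by (simp add: if_distrib cong: if_cong)
  finally show ?thesis by simp
qed

lemma pc_on_cell:
  assumes j: "j \<in> {1..N}" and s: "s \<in> cell j"
  shows "pc y s = y j"
proof -
  have "s \<notin> cell i" if "i \<in> {1..N}" "i \<noteq> j" for i
  proof (cases "i < j")
    case True
    then have "x i \<le> x (j - 1)" using j by (intro x_mono) auto
    then show ?thesis using s by simp
  next
    case False
    then have "x j \<le> x (i - 1)" using that by (intro x_mono) auto
    then show ?thesis using s by simp
  qed
  then have "pc y s = (\<Sum>i\<in>{1..N}. if i = j then y i else 0)"
    using s unfolding pc_def by (intro sum.cong) auto
  then show ?thesis using j by simp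
qed

lemma pl_deriv:
  assumes j: "j \<in> {1..N}" and s: "s \<in> cell j"
  shows "(pl y has_real_derivative pc y s) (at s)"
proof -
  have "((\<lambda>s. pl y (x (j - 1)) + y j * (s - x (j - 1))) has_real_derivative pc y s) (at s)"
    unfolding pc_on_cell[OF assms] by (auto intro!: derivative_eq_intros)
  then show ?thesis
  proof (rule has_field_derivative_transform_within_open[of _ _ _ "cell j"])
    fix t assume "t \<in> cell j"
    then show "pl y (x (j - 1)) + y j * (t - x (j - 1)) = pl y t"
      by (intro pl_on_cell[OF j, symmetric]) auto
  qed (use s in auto)
qed

lemma ramp_nonneg: "j \<in> {1..N} \<Longrightarrow> 0 \<le> ramp j s"
  and ramp_le_1: "j \<in> {1..N} \<Longrightarrow> ramp j s \<le> 1"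
  using x_step[of j] x_range(2)[of j] x_range(1)[of "j - 1"] by (auto simp: ramp_def le_diff_conv min_def)

lemma continuous_on_ramp: "continuous_on A (ramp j)"
  unfolding ramp_def by (intro continuous_intros)

lemma continuous_on_pl: "continuous_on A (pl y)"
  unfolding pl_def by (intro continuous_intros continuous_on_ramp)

lemma pl_0: "pl y 0 = 0"
  unfolding pl_def by (rule sum.neutral) (use x_step x_range in \<open>fastforce simp: ramp_def\<close>)

lemma pl_abs_le: "\<bar>pl y s\<bar> \<le> (\<Sum>j\<in>{1..N}. \<bar>y j\<bar>)"
  unfolding pl_def using ramp_nonneg ramp_le_1
  by (intro order_trans[OF sum_abs] sum_mono) (auto simp: abs_mult intro!: mult_left_le)

lemma pl_diff: "pl (\<lambda>i. y i - z i) s = pl y s - pl z s"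
  by (simp add: pl_def left_diff_distrib sum_subtractf)

lemma pc_diff: "pc (\<lambda>i. y i - z i) s = pc y s - pc z s"
  by (simp add: pc_def left_diff_distrib sum_subtractf)

lemma L2_ramp: "ramp j \<in> L2"
  by (intro L2_continuous_on continuous_on_ramp)

lemma L2_pl: "pl y \<in> L2"
  by (intro L2_continuous_on continuous_on_pl)

lemma L2_indicator_cell: "indicator (cell j) \<in> L2"
  by (rule L2_bounded[of _ 1]) (auto intro!: borel_measurable_unit_leb split: split_indicator)

lemma L2_pc: "pc y \<in> L2"
  unfolding pc_def by (intro L2_sum L2_scale L2_indicator_cell)

lemma pl_fe_space: "pl y \<in> fe_space N x"
proof -
  have "\<exists>p :: real poly. degree p \<le> 1 \<and> (\<forall>s\<in>cell j. pl y s = poly p s)" if j: "j \<in> {1..N}" for j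
  proof (intro exI conjI ballI)
    fix s assume "s \<in> cell j"
    then have "pl y s = pl y (x (j - 1)) + y j * (s - x (j - 1))"
      by (intro pl_on_cell[OF j]) auto
    then show "pl y s = poly [:pl y (x (j - 1)) - y j * x (j - 1), y j:] s"
      by (simp add: algebra_simps)
  qed simp
  then show ?thesis by (simp add: fe_space_def continuous_on_pl pl_0)
qed

text \<open>With \<open>y\<close> the slopes of \<open>v\<close>, the difference
  \<open>v - pl y\<close> is continuous, vanishes at 0 and has derivative 0 off the finitely many
  nodes, so it is zero. Continuity is what fixes the constants across the nodes.\<close>

lemma fe_space_eq_pl:
  assumes v: "v \<in> fe_space N x"
  shows "\<exists>y. \<forall>s\<in>{0..1}. v s = pl y s"
proof -
  from v obtain p :: "nat \<Rightarrow> real poly" where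
    p: "\<And>j. j \<in> {1..N} \<Longrightarrow> degree (p j) \<le> 1"
      "\<And>j s. j \<in> {1..N} \<Longrightarrow> s \<in> cell j \<Longrightarrow> v s = poly (p j) s"
    unfolding fe_space_def mem_Collect_eq by metis
  define y where "y j = coeff (p j) 1" for j
  have affine: "v s = coeff (p j) 0 + y j * s" if "j \<in> {1..N}" "s \<in> cell j" for j s
  proof -
    have "p j = [:coeff (p j) 0, coeff (p j) 1:]"
      using p(1)[OF that(1)] by (intro poly_eqI) (auto simp: coeff_pCons coeff_eq_0 split: nat.split)
    then have "poly (p j) s = coeff (p j) 0 + y j * s"
      unfolding y_def by (metis mult.commute mult_zero_right poly_0 poly_pCons add_0_right)
    then show ?thesis using p(2)[OF that] by simp
  qed
  have "v s - pl y s = 0" if s: "s \<in> {0..1}" for s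
  proof (rule has_derivative_zero_unique_strong_interval[of "x ` {..N}" 0 1 "\<lambda>s. v s - pl y s"])
    show "continuous_on {0..1} (\<lambda>s. v s - pl y s)"
      using v by (intro continuous_intros continuous_on_pl) (simp add: fe_space_def)
    show "v 0 - pl y 0 = 0"
      using v by (simp add: pl_0 fe_space_def)
    fix s assume "s \<in> {0..1} - x ` {..N}"
    then obtain j where j: "j \<in> {1..N}" "s \<in> cell j"
      using cell_cover by blast
    have "((\<lambda>s. coeff (p j) 0 + y j * s) has_real_derivative y j) (at s)"
      by (auto intro!: derivative_eq_intros)
    then have "(v has_real_derivative y j) (at s)"
      by (rule has_field_derivative_transform_within_open[of _ _ _ "cell j"])
        (use j affine in auto)
    then have "((\<lambda>s. v s - pl y s) has_real_derivative y j - pc y s) (at s)"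
      by (intro DERIV_diff pl_deriv[OF j])
    then have "((\<lambda>s. v s - pl y s) has_real_derivative 0) (at s)"
      using pc_on_cell[OF j, of y] by simp
    then have "((\<lambda>s. v s - pl y s) has_derivative (\<lambda>h. 0)) (at s)"
      by (simp add: has_field_derivative_def lambda_zero)
    then show "((\<lambda>s. v s - pl y s) has_derivative (\<lambda>h. 0)) (at s within {0..1})"
      by (rule has_derivative_at_withinI)
  qed (use s in auto)
  then show ?thesis by (intro exI[of _ y]) simp
qed

text \<open>Integration by parts: the product of \<open>pl y\<close> and a test function is
  continuous, differentiable off the nodes, and zero at both ends, so the fundamental theorem of
  calculus with finitely many exceptional points gives integral 0.\<close>

lemma has_weak_deriv_pl: "has_weak_deriv (pl y) (pc y)"
  unfolding has_weak_deriv_def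
proof (intro conjI ballI L2_pc)
  fix \<phi> assume \<phi>: "\<phi> \<in> test_functions"
  let ?f = "\<lambda>s. pl y s * deriv \<phi> s + pc y s * \<phi> s"
  have int: "integrable unit_leb (\<lambda>s. pl y s * deriv \<phi> s)" "integrable unit_leb (\<lambda>s. pc y s * \<phi> s)"
    using deriv_test_function(2)[OF \<phi>] test_function_L2[OF \<phi>]
    by (auto intro: L2_integrable_mult L2_pl L2_pc)
  have "(?f has_integral (pl y 1 * \<phi> 1 - pl y 0 * \<phi> 0)) {0..1}"
  proof (rule fundamental_theorem_of_calculus_interior_strong[of "x ` {..N}"])
    fix s assume s: "s \<in> {0<..<1} - x ` {..N}"
    then obtain j where j: "j \<in> {1..N}" "s \<in> cell j"
      using cell_cover[of s] by auto
    have "((\<lambda>s. pl y s * \<phi> s) has_real_derivative (pc y s * \<phi> s + deriv \<phi> s * pl y s)) (at s)"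
      by (rule DERIV_mult[OF pl_deriv[OF j] deriv_test_function(1)[OF \<phi>]])
    then show "((\<lambda>s. pl y s * \<phi> s) has_vector_derivative ?f s) (at s)"
      by (simp add: has_real_derivative_iff_has_vector_derivative mult.commute add.commute)
  next
    have "continuous_on {0..1} \<phi>"
      using deriv_test_function(1)[OF \<phi>] by (meson DERIV_isCont continuous_at_imp_continuous_on)
    then show "continuous_on {0..1} (\<lambda>s. pl y s * \<phi> s)"
      by (intro continuous_intros continuous_on_pl)
  qed auto
  then have "(?f has_integral 0) {0<..<1}"
    using test_function_boundary[OF \<phi>] by (simp add: has_integral_Icc_iff_Ioo)
  moreover have "(?f has_integral (LINT s|unit_leb. ?f s)) {0<..<1}"
    using int by (intro has_integral_integral_lebesgue_on) auto
  ultimately have "(LINT s|unit_leb. ?f s) = 0"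
    by (rule has_integral_unique[symmetric])
  then show "L2_inner (pl y) (deriv \<phi>) = - L2_inner (pc y) \<phi>"
    using int by (simp add: L2_inner_def)
qed

lemma pl_H1: "pl y \<in> H1"
  using has_weak_deriv_pl L2_pl by (auto simp: H1_def)

text \<open>A finite element function is arbitrary outside the closed unit interval, so it need not
  equal \<open>pl y\<close> as a function on the line; the chosen weak derivative is still
  \<open>pc y\<close> up to a null set.\<close>

lemma weak_deriv_AE_pc:
  assumes "\<And>s. s \<in> {0..1} \<Longrightarrow> v s = pl y s"
  shows "weak_deriv v \<in> L2" "AE s in unit_leb. weak_deriv v s = pc y s"
proof -
  have "L2_inner v \<phi> = L2_inner (pl y) \<phi>" for \<phi>
    using assms by (intro L2_inner_cong) auto
  then have "has_weak_deriv v (pc y)"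
    using has_weak_deriv_pl[of y] by (simp add: has_weak_deriv_def)
  then show "weak_deriv v \<in> L2" "AE s in unit_leb. weak_deriv v s = pc y s"
    by (rule weak_deriv_AE_eq)+
qed

section \<open>Coercivity of the L2 norm in the slopes\<close>

text \<open>Over an interval of length \<open>l\<close>, the square of an affine function integrates
  to \<open>l\<close> times the squared midpoint value plus \<open>l^3 / 12\<close> times the
  squared slope. The midpoint term is dropped.\<close>

lemma slope_le_L2_norm:
  assumes j: "j \<in> {1..N}"
  shows "(x j - x (j - 1)) ^ 3 / 12 * (y j)\<^sup>2 \<le> (L2_norm (pl y))\<^sup>2"
proof -
  define a where "a = x (j - 1)"
  define b where "b = x j"
  define \<alpha> where "\<alpha> = pl y a"
  have ab: "0 \<le> a" "a < b" "b \<le> 1"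
    using j x_step[OF j] x_range by (auto simp: a_def b_def)
  define F where "F s = \<alpha>\<^sup>2 * (s - a) + \<alpha> * y j * (s - a)\<^sup>2 + (y j)\<^sup>2 / 3 * (s - a) ^ 3" for s
  have "((\<lambda>s. (pl y s)\<^sup>2) has_integral (F b - F a)) {a..b}"
  proof (rule fundamental_theorem_of_calculus)
    fix s assume s: "s \<in> {a..b}"
    have "(F has_real_derivative (\<alpha> + y j * (s - a))\<^sup>2) (at s within {a..b})"
      unfolding F_def[abs_def]
      by (auto intro!: derivative_eq_intros simp: power2_eq_square algebra_simps
          add_divide_distrib diff_divide_distrib)
    then show "(F has_vector_derivative (pl y s)\<^sup>2) (at s within {a..b})"
      using pl_on_cell[OF j, of s y] s
      by (simp add: has_real_derivative_iff_has_vector_derivative a_def b_def \<alpha>_def)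
  qed (use ab in auto)
  then have ab_int: "integral {a..b} (\<lambda>s. (pl y s)\<^sup>2) = F b - F a"
    by (rule integral_unique)
  have "(b - a) ^ 3 / 12 * (y j)\<^sup>2 \<le> (b - a) ^ 3 / 12 * (y j)\<^sup>2 + (b - a) * (\<alpha> + y j * (b - a) / 2)\<^sup>2"
    using ab by simp
  also have "\<dots> = F b - F a"
    by (simp add: F_def power2_eq_square power3_eq_cube field_simps)
  also have "\<dots> \<le> integral {0..1} (\<lambda>s. (pl y s)\<^sup>2)"
    unfolding ab_int[symmetric]
    using ab by (intro integral_subset_le integrable_continuous_interval continuous_intros continuous_on_pl) auto
  also have "\<dots> = (L2_norm (pl y))\<^sup>2"
  proof -
    have "((\<lambda>s. pl y s * pl y s) has_integral (LINT s|unit_leb. pl y s * pl y s)) {0<..<1}"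
      using L2_integrable_mult[OF L2_pl L2_pl] by (intro has_integral_integral_lebesgue_on) auto
    then show ?thesis
      unfolding L2_norm_power2 L2_inner_def
      by (intro integral_unique) (simp add: has_integral_Icc_iff_Ioo power2_eq_square)
  qed
  finally show ?thesis by (simp add: a_def b_def)
qed

text \<open>This converts monotonicity in the L2 norm into strong monotonicity in the coefficient
  vector. Summing the cell estimates gives the constant \<open>C\<close>; adding 1 makes its inverse
  positive at once.\<close>

lemma L2_norm_pl_coercive:
  "\<exists>m>0. \<forall>y. m * (\<Sum>j\<in>{1..N}. (y j)\<^sup>2) \<le> (L2_norm (pl y))\<^sup>2"
proof -
  define C where "C = (\<Sum>j\<in>{1..N}. 12 / (x j - x (j - 1)) ^ 3)"
  have pos: "0 < (x j - x (j - 1)) ^ 3" if "j \<in> {1..N}" for j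
    using x_step[OF that] by simp
  have "C \<ge> 0"
    unfolding C_def using pos by (intro sum_nonneg divide_nonneg_pos) auto
  have "(\<Sum>j\<in>{1..N}. (y j)\<^sup>2) \<le> (C + 1) * (L2_norm (pl y))\<^sup>2" for y
  proof -
    have "(\<Sum>j\<in>{1..N}. (y j)\<^sup>2) \<le> (\<Sum>j\<in>{1..N}. 12 / (x j - x (j - 1)) ^ 3 * (L2_norm (pl y))\<^sup>2)"
      using slope_le_L2_norm[of _ y] pos by (intro sum_mono) (simp add: field_simps)
    also have "\<dots> = C * (L2_norm (pl y))\<^sup>2"
      by (simp add: C_def sum_distrib_right)
    also have "\<dots> \<le> (C + 1) * (L2_norm (pl y))\<^sup>2"
      by (intro mult_right_mono) auto
    finally show ?thesis .
  qed
  then show ?thesis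
    using \<open>C \<ge> 0\<close> by (intro exI[of _ "1 / (C + 1)"]) (auto simp: field_simps)
qed

end

section \<open>The backward Euler scheme\<close>

definition clamped_cube :: "real \<Rightarrow> real \<Rightarrow> real" where
  "clamped_cube M t = (max (- M) (min M t)) ^ 3"

lemma clamped_cube_eq: "\<bar>t\<bar> \<le> M \<Longrightarrow> clamped_cube M t = t ^ 3"
  by (simp add: clamped_cube_def abs_le_iff)

lemma clamped_cube_0: "M \<ge> 0 \<Longrightarrow> clamped_cube M 0 = 0"
  by (simp add: clamped_cube_eq)

lemma continuous_on_clamped_cube: "continuous_on A f \<Longrightarrow> continuous_on A (\<lambda>s. clamped_cube M (f s))"
  unfolding clamped_cube_def by (intro continuous_intros)

lemma clamped_cube_mono: "0 \<le> (clamped_cube M s - clamped_cube M t) * (s - t)"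
proof (cases "s \<le> t")
  case True
  then have "clamped_cube M s \<le> clamped_cube M t"
    unfolding clamped_cube_def by (intro power_mono_odd) (auto simp: max_def min_def)
  then show ?thesis using True by (intro mult_nonpos_nonpos) auto
next
  case False
  then have "clamped_cube M t \<le> clamped_cube M s"
    unfolding clamped_cube_def by (intro power_mono_odd) (auto simp: max_def min_def)
  then show ?thesis using False by (intro mult_nonneg_nonneg) auto
qed

text \<open>Clamping does not increase distances, and in the factorisation of a difference of cubes
  each of the three terms of the quadratic factor is at most the square of \<open>M\<close>.\<close>

lemma clamped_cube_lipschitz:
  assumes "M \<ge> 0"
  shows "\<bar>clamped_cube M s - clamped_cube M t\<bar> \<le> 3 * M\<^sup>2 * \<bar>s - t\<bar>"
proof -
  define a where "a = max (- M) (min M s)"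
  define b where "b = max (- M) (min M t)"
  have ab: "\<bar>a\<bar> \<le> M" "\<bar>b\<bar> \<le> M" "\<bar>a - b\<bar> \<le> \<bar>s - t\<bar>"
    using assms by (auto simp: a_def b_def max_def min_def)
  have sq: "a\<^sup>2 \<le> M\<^sup>2" "b\<^sup>2 \<le> M\<^sup>2" "\<bar>a * b\<bar> \<le> M\<^sup>2"
    using ab assms abs_le_square_iff[of a M] abs_le_square_iff[of b M] mult_mono[of "\<bar>a\<bar>" M "\<bar>b\<bar>" M]
    by (auto simp: abs_mult power2_eq_square)
  have "\<bar>a ^ 3 - b ^ 3\<bar> = \<bar>a\<^sup>2 + a * b + b\<^sup>2\<bar> * \<bar>a - b\<bar>"
    by (simp add: abs_mult[symmetric] power2_eq_square power3_eq_cube algebra_simps)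
  also have "\<dots> \<le> (3 * M\<^sup>2) * \<bar>s - t\<bar>"
  proof (intro mult_mono ab(3))
    show "\<bar>a\<^sup>2 + a * b + b\<^sup>2\<bar> \<le> 3 * M\<^sup>2"
      using sq zero_le_power2[of a] zero_le_power2[of b] by linarith
  qed auto
  finally show ?thesis by (simp add: clamped_cube_def a_def b_def)
qed

text \<open>The interval has measure one, so no further constant appears. This bounds the cubic part
  of the system against the ramps.\<close>

lemma L2_inner_abs_le:
  assumes "f \<in> L2" "g \<in> L2" and B: "\<And>s. \<bar>f s\<bar> \<le> B" and g: "\<And>s. \<bar>g s\<bar> \<le> 1"
  shows "\<bar>L2_inner f g\<bar> \<le> B"
proof -
  have "B \<ge> 0" using B[of 0] by linarith
  have "\<bar>L2_inner f g\<bar> \<le> (LINT s|unit_leb. \<bar>f s * g s\<bar>)"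
    unfolding L2_inner_def by (rule integral_abs_bound)
  also have "\<dots> \<le> (LINT s|unit_leb. B)"
  proof (rule integral_mono)
    show "integrable unit_leb (\<lambda>s. \<bar>f s * g s\<bar>)"
      using L2_integrable_mult[OF assms(1,2)] by simp
    show "integrable unit_leb (\<lambda>s. B)"
      by (rule finite_measure.integrable_const[OF finite_measure_unit_leb])
    show "\<bar>f s * g s\<bar> \<le> B" for s
      using mult_mono[OF B[of s] g[of s] \<open>B \<ge> 0\<close>] by (simp add: abs_mult)
  qed
  also have "\<dots> = B"
    by (simp add: measure_restrict_space)
  finally show ?thesis .
qed

section \<open>Solving the scheme in slope coordinates\<close>

context mesh
begin

lemma ramp_eq_pl: "j \<in> {1..N} \<Longrightarrow> ramp j = pl (\<lambda>i. if i = j then 1 else 0)"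
  by (rule ext) (simp add: pl_def if_distrib[of "\<lambda>a. a * _"] cong: if_cong)

lemma ramp_H1: "j \<in> {1..N} \<Longrightarrow> ramp j \<in> H1"
  by (simp add: ramp_eq_pl pl_H1)

lemma ramp_abs_le_1: "j \<in> {1..N} \<Longrightarrow> \<bar>ramp j s\<bar> \<le> 1"
  using ramp_nonneg[of j s] ramp_le_1[of j s] by simp

lemma L2_inner_pl_left: "g \<in> L2 \<Longrightarrow> L2_inner (pl y) g = (\<Sum>j\<in>{1..N}. y j * L2_inner (ramp j) g)"
  unfolding pl_def[abs_def] by (intro L2_inner_sum L2_ramp)

lemma L2_inner_pc_left:
  "g \<in> L2 \<Longrightarrow> L2_inner (pc y) g = (\<Sum>j\<in>{1..N}. y j * L2_inner (indicator (cell j)) g)"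
  unfolding pc_def[abs_def] by (intro L2_inner_sum L2_indicator_cell)

lemma L2_inner_pl_right: "g \<in> L2 \<Longrightarrow> L2_inner g (pl y) = (\<Sum>j\<in>{1..N}. y j * L2_inner g (ramp j))"
  using L2_inner_pl_left[of g y] by (simp add: L2_inner_commute[of g])

lemma L2_inner_pc_right:
  "g \<in> L2 \<Longrightarrow> L2_inner g (pc y) = (\<Sum>j\<in>{1..N}. y j * L2_inner g (indicator (cell j)))"
  using L2_inner_pc_left[of g y] by (simp add: L2_inner_commute[of g])

text \<open>The scheme with all terms on one side: the mass terms of the time difference and of the
  \<open>\<gamma>\<close> term are merged, \<open>pc\<close> replaces the weak derivatives, and
  \<open>pl w\<close> ranges over the test functions.\<close>

lemma scheme_slope_solution:
  fixes \<nu> \<gamma> \<delta> \<mu> c h k :: real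
  assumes J: "interpolation_operator c h J"
    and \<delta>: "\<delta> \<ge> 0" and \<mu>: "\<mu> > 0" and k: "k > 0"
    and \<nu>: "\<nu> \<ge> \<mu> * c\<^sup>2 * h\<^sup>2 / 2"
    and k_small: "k * (\<gamma> + \<mu> * c\<^sup>2 * h\<^sup>2 / 2) < 1"
    and Y\<^sub>0: "Y\<^sub>0 \<in> L2"
  shows "\<exists>y. \<forall>w. (1 / k - \<gamma>) * L2_inner (pl y) (pl w) + \<nu> * L2_inner (pc y) (pc w)
    + \<mu> * L2_inner (J (pl y)) (pl w) + \<delta> * L2_inner (\<lambda>s. (pl y s) ^ 3) (pl w)
    - L2_inner Y\<^sub>0 (pl w) / k = 0"
proof -
  \<comment> \<open>The monotonicity constant: \<open>1 / k - \<gamma>\<close> comes from the mass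
    terms, the rest from the L2 part of the feedback estimate.\<close>
  define \<beta> where "\<beta> = 1 / k - \<gamma> - \<mu> * c\<^sup>2 * h\<^sup>2 / 2 + \<mu> / 2"
  have "1 / k - \<gamma> - \<mu> * c\<^sup>2 * h\<^sup>2 / 2 > 0"
    using k k_small by (simp add: field_simps)
  then have \<beta>: "\<beta> > 0" using \<mu> by (simp add: \<beta>_def)
  obtain m where m: "m > 0" and m_le: "\<And>y. m * (\<Sum>j\<in>{1..N}. (y j)\<^sup>2) \<le> (L2_norm (pl y))\<^sup>2"
    using L2_norm_pl_coercive by blast

  define u where "u s = Y\<^sub>0 s / (k * \<beta>)" for s
  have u: "u \<in> L2" unfolding u_def by (rule L2_divide[OF Y\<^sub>0])
  \<comment> \<open>Testing the equation with its solution will give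
    \<open>(L2_norm (pl y))\<^sup>2 \<le> L2_inner u u\<close> whatever the clamping level.
    Coercivity with \<open>m\<close> and Cauchy-Schwarz over the \<open>N\<close> slopes then bound
    the sum of their absolute values by this \<open>M\<close>, so the choice is not
    circular.\<close>
  define M where "M = sqrt (N * (L2_inner u u / m))"
  have M: "M \<ge> 0" using m by (simp add: M_def L2_inner_nonneg)

  \<comment> \<open>The test function \<open>g\<close> and its derivative \<open>d\<close> are
    separate arguments, so that both a basis ramp with its cell indicator and a pair
    \<open>pl w\<close>, \<open>pc w\<close> can be inserted.\<close>
  define lin where "lin y g d = (1 / k - \<gamma>) * L2_inner (pl y) g + \<nu> * L2_inner (pc y) d
    + \<mu> * L2_inner (J (pl y)) g" for y g d
  define T where "T y s = clamped_cube M (pl y s)" for y s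
  have T: "T y \<in> L2" for y
    unfolding T_def by (intro L2_continuous_on continuous_on_clamped_cube continuous_on_pl)
  define G where "G y i = lin y (ramp i) (indicator (cell i)) + \<delta> * L2_inner (T y) (ramp i)
    - L2_inner Y\<^sub>0 (ramp i) / k" for y i
  have JL: "J (pl y) \<in> L2" for y
    by (rule interpolation_L2[OF J pl_H1])

  \<comment> \<open>Weighting the equations by \<open>w\<close> is the same as testing with
    \<open>pl w\<close>; this transfers monotonicity to \<open>G\<close> and, at the end, zeros of
    \<open>G\<close> to solutions of the scheme.\<close>
  have test: "(\<Sum>i\<in>{1..N}. G y i * w i)
      = lin y (pl w) (pc w) + \<delta> * L2_inner (T y) (pl w) - L2_inner Y\<^sub>0 (pl w) / k" for y w
    unfolding G_def lin_def
    by (simp add: L2_inner_pl_right[where y = w] L2_inner_pc_right[where y = w]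
        L2_pl L2_pc JL T Y\<^sub>0
        sum_distrib_left sum_divide_distrib sum.distrib sum_subtractf algebra_simps)

  \<comment> \<open>Matrix of the linear part in the ramp basis; its entries give the Lipschitz
    bound.\<close>
  define a where "a i j = (1 / k - \<gamma>) * L2_inner (ramp j) (ramp i)
    + \<nu> * L2_inner (indicator (cell j)) (indicator (cell i)) + \<mu> * L2_inner (J (ramp j)) (ramp i)" for i j
  have lin_diff: "lin y g d - lin z g d = lin (\<lambda>i. y i - z i) g d" if "g \<in> L2" "d \<in> L2" for y z g d
  proof -
    have "pl (\<lambda>i. y i - z i) = (\<lambda>s. 1 * pl y s + (-1) * pl z s)"
      by (simp add: fun_eq_iff pl_diff)
    then have 1: "L2_inner (J (pl (\<lambda>i. y i - z i))) g = L2_inner (J (pl y)) g - L2_inner (J (pl z)) g"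
      using L2_inner_interpolation_lincomb[OF J pl_H1 pl_H1 that(1), of 1 y "-1" z] by simp
    have 2: "L2_inner (pl (\<lambda>i. y i - z i)) g = L2_inner (pl y) g - L2_inner (pl z) g"
      unfolding pl_diff by (rule L2_inner_diff[OF L2_pl L2_pl that(1)])
    have 3: "L2_inner (pc (\<lambda>i. y i - z i)) d = L2_inner (pc y) d - L2_inner (pc z) d"
      unfolding pc_diff by (rule L2_inner_diff[OF L2_pc L2_pc that(2)])
    show ?thesis unfolding lin_def 1 2 3 by (simp add: algebra_simps)
  qed
  have lin_matrix: "lin w (ramp i) (indicator (cell i)) = (\<Sum>j\<in>{1..N}. w j * a i j)" for w i
  proof -
    have "L2_inner (J (pl w)) (ramp i) = (\<Sum>j\<in>{1..N}. w j * L2_inner (J (ramp j)) (ramp i))"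
      unfolding pl_def[abs_def] by (intro L2_inner_interpolation_sum[OF J] ramp_H1 L2_ramp) auto
    then show ?thesis
      unfolding lin_def a_def L2_inner_pl_left[OF L2_ramp] L2_inner_pc_left[OF L2_indicator_cell]
      by (simp add: sum_distrib_left sum.distrib sum_subtractf algebra_simps)
  qed

  \<comment> \<open>The feedback estimate is scaled by \<open>\<mu> / 2\<close>; the lower bound on
    \<open>\<nu>\<close> lets the diffusion absorb the derivative part of the interpolation
    error.\<close>
  have coercive: "\<beta> * (L2_norm (pl w))\<^sup>2 \<le> lin w (pl w) (pc w)" for w
  proof -
    have wd: "(L2_norm (weak_deriv (pl w)))\<^sup>2 = L2_inner (pc w) (pc w)"
      unfolding L2_norm_power2 using weak_deriv_AE_pc[of "pl w" w] L2_pc[of w]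
      by (intro L2_inner_cong_AE) (auto intro: L2_borel_measurable)
    have "\<mu> / 2 * ((L2_norm (pl w))\<^sup>2 - c\<^sup>2 * h\<^sup>2 * ((L2_norm (pl w))\<^sup>2 + L2_inner (pc w) (pc w)))
        \<le> \<mu> / 2 * (2 * L2_inner (J (pl w)) (pl w))"
      using interpolation_coercive[OF J pl_H1, of w] \<mu> unfolding wd by (intro mult_left_mono) auto
    moreover have "\<mu> * c\<^sup>2 * h\<^sup>2 / 2 * L2_inner (pc w) (pc w) \<le> \<nu> * L2_inner (pc w) (pc w)"
      using \<nu> by (intro mult_right_mono L2_inner_nonneg)
    ultimately show ?thesis
      by (simp add: lin_def \<beta>_def L2_norm_power2 algebra_simps)
  qed

  have T_mono: "0 \<le> L2_inner (\<lambda>s. T y s - T z s) (pl (\<lambda>i. y i - z i))" for y z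
    unfolding L2_inner_def T_def pl_diff by (intro Bochner_Integration.integral_nonneg clamped_cube_mono)

  have "\<exists>y. \<forall>i\<in>{1..N}. G y i = 0"
  proof (rule strongly_monotone_lipschitz_zero)
    show "\<beta> * m > 0" using \<beta> m by simp
  next
    fix y z :: "nat \<Rightarrow> real"
    define w where "w i = y i - z i" for i
    have "\<beta> * m * (\<Sum>i\<in>{1..N}. (w i)\<^sup>2) \<le> \<beta> * (L2_norm (pl w))\<^sup>2"
      using m_le[of w] \<beta> by simp
    also have "\<dots> \<le> lin w (pl w) (pc w)"
      by (rule coercive)
    also have "\<dots> \<le> lin w (pl w) (pc w) + \<delta> * L2_inner (\<lambda>s. T y s - T z s) (pl w)"
      using T_mono[of y z] \<delta> by (simp add: w_def[abs_def])
    also have "\<dots> = (\<Sum>i\<in>{1..N}. G y i * w i) - (\<Sum>i\<in>{1..N}. G z i * w i)"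
      unfolding test
      using lin_diff[OF L2_pl L2_pc, of y w w z]
      unfolding w_def[symmetric] L2_inner_diff[OF T T L2_pl] by (simp add: algebra_simps)
    also have "\<dots> = (\<Sum>i\<in>{1..N}. (G y i - G z i) * w i)"
      by (simp add: sum_subtractf left_diff_distrib)
    finally show "\<beta> * m * (\<Sum>i\<in>{1..N}. (y i - z i)\<^sup>2) \<le> (\<Sum>i\<in>{1..N}. (G y i - G z i) * (y i - z i))"
      by (simp add: w_def)
  next
    fix y z :: "nat \<Rightarrow> real" and i
    assume i: "i \<in> {1..N}"
    define w where "w i = y i - z i" for i
    \<comment> \<open>Summing over all matrix entries gives one constant valid for every row
      \<open>i\<close>, as the fixed-point lemma demands.\<close>
    define Q where "Q = (\<Sum>(i, j)\<in>{1..N} \<times> {1..N}. \<bar>a i j\<bar>)"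
    have "\<bar>a i j\<bar> \<le> Q" if "j \<in> {1..N}" for j
      unfolding Q_def using member_le_sum[of "(i, j)" "{1..N} \<times> {1..N}" "\<lambda>(i, j). \<bar>a i j\<bar>"] that i by auto
    then have "\<bar>lin w (ramp i) (indicator (cell i))\<bar> \<le> (\<Sum>j\<in>{1..N}. \<bar>w j\<bar> * Q)"
      unfolding lin_matrix
      by (intro order_trans[OF sum_abs] sum_mono) (auto simp: abs_mult intro!: mult_left_mono)
    moreover have "\<bar>L2_inner (\<lambda>s. T y s - T z s) (ramp i)\<bar> \<le> 3 * M\<^sup>2 * (\<Sum>j\<in>{1..N}. \<bar>w j\<bar>)"
    proof (rule L2_inner_abs_le)
      fix s
      have "\<bar>T y s - T z s\<bar> \<le> 3 * M\<^sup>2 * \<bar>pl w s\<bar>"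
        unfolding T_def w_def pl_diff by (rule clamped_cube_lipschitz[OF M])
      also have "\<dots> \<le> 3 * M\<^sup>2 * (\<Sum>j\<in>{1..N}. \<bar>w j\<bar>)"
        by (intro mult_left_mono pl_abs_le) auto
      finally show "\<bar>T y s - T z s\<bar> \<le> 3 * M\<^sup>2 * (\<Sum>j\<in>{1..N}. \<bar>w j\<bar>)" .
    qed (use i in \<open>auto intro: L2_diff T L2_ramp ramp_abs_le_1\<close>)
    then have "\<bar>\<delta> * L2_inner (\<lambda>s. T y s - T z s) (ramp i)\<bar> \<le> \<delta> * (3 * M\<^sup>2 * (\<Sum>j\<in>{1..N}. \<bar>w j\<bar>))"
      using \<delta> by (simp add: abs_mult mult_left_mono)
    moreover have "G y i - G z i
        = lin w (ramp i) (indicator (cell i)) + \<delta> * L2_inner (\<lambda>s. T y s - T z s) (ramp i)"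
      unfolding G_def
      using lin_diff[OF L2_ramp L2_indicator_cell, of y i i z]
      unfolding w_def[symmetric] L2_inner_diff[OF T T L2_ramp] by (simp add: algebra_simps)
    ultimately have "\<bar>G y i - G z i\<bar>
        \<le> (\<Sum>j\<in>{1..N}. \<bar>w j\<bar> * Q) + \<delta> * (3 * M\<^sup>2 * (\<Sum>j\<in>{1..N}. \<bar>w j\<bar>))"
      by linarith
    then show "\<bar>G y i - G z i\<bar>
        \<le> ((\<Sum>(i, j)\<in>{1..N} \<times> {1..N}. \<bar>a i j\<bar>) + \<delta> * (3 * M\<^sup>2)) * (\<Sum>j\<in>{1..N}. \<bar>y j - z j\<bar>)"
      unfolding Q_def[symmetric] by (simp add: w_def sum_distrib_left algebra_simps)
  qed simp
  then obtain y where y: "\<And>i. i \<in> {1..N} \<Longrightarrow> G y i = 0" by blast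

  \<comment> \<open>A priori bound: the solution is tested with itself, the cubic term is
    nonnegative by monotonicity against 0, and Young's inequality absorbs half of the squared
    norm.\<close>
  have "(L2_norm (pl y))\<^sup>2 \<le> L2_inner u u"
  proof -
    have "T (\<lambda>_. 0) = (\<lambda>_. 0)"
      using M by (simp add: fun_eq_iff T_def pl_def clamped_cube_0)
    then have "0 \<le> \<delta> * L2_inner (T y) (pl y)"
      using T_mono[of y "\<lambda>_. 0"] \<delta> by simp
    moreover have "lin y (pl y) (pc y) + \<delta> * L2_inner (T y) (pl y) - L2_inner Y\<^sub>0 (pl y) / k = 0"
      unfolding test[symmetric] using y by simp
    moreover have "L2_inner Y\<^sub>0 (pl y) / k = \<beta> * L2_inner u (pl y)"
      using k \<beta> by (simp add: u_def[abs_def] L2_inner_divide)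
    ultimately have "\<beta> * (L2_norm (pl y))\<^sup>2 \<le> \<beta> * L2_inner u (pl y)"
      using coercive[of y] by linarith
    then have "(L2_norm (pl y))\<^sup>2 \<le> L2_inner u (pl y)"
      using \<beta> by simp
    then show ?thesis
      using L2_inner_young[OF u L2_pl, of y] by (simp add: L2_norm_power2)
  qed
  then have "m * (\<Sum>j\<in>{1..N}. (y j)\<^sup>2) \<le> L2_inner u u"
    using m_le[of y] by linarith
  then have "(\<Sum>j\<in>{1..N}. (y j)\<^sup>2) \<le> L2_inner u u / m"
    using m by (simp add: field_simps)
  then have "(\<Sum>j\<in>{1..N}. (y j)\<^sup>2) * N \<le> L2_inner u u / m * N"
    by (rule mult_right_mono) simp
  then have "(\<Sum>j\<in>{1..N}. \<bar>y j\<bar>)\<^sup>2 \<le> N * (L2_inner u u / m)"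
    using sum_squared_le_sum_of_squares[of "\<lambda>j. \<bar>y j\<bar>" "{1..N}"] by (simp add: mult.commute)
  then have "(\<Sum>j\<in>{1..N}. \<bar>y j\<bar>) \<le> M"
    unfolding M_def by (rule real_le_rsqrt)
  \<comment> \<open>The bound holds at every point, so the clamp is inactive along the solution and
    the truncated system is the original one.\<close>
  then have "\<bar>pl y s\<bar> \<le> M" for s
    using pl_abs_le[of y s] by linarith
  then have "T y = (\<lambda>s. (pl y s) ^ 3)"
    by (simp add: fun_eq_iff T_def clamped_cube_eq)
  moreover have "lin y (pl w) (pc w) + \<delta> * L2_inner (T y) (pl w) - L2_inner Y\<^sub>0 (pl w) / k = 0" for w
    unfolding test[symmetric] using y by simp
  ultimately show ?thesis
    unfolding lin_def by (intro exI[of _ y]) simp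
qed

end

theorem theorem4p2:
  fixes \<nu> \<gamma> \<delta> \<mu> c\<^sub>p h k :: real
    and N :: nat and x :: "nat \<Rightarrow> real"
    and I\<^sub>h :: "(real \<Rightarrow> real) \<Rightarrow> (real \<Rightarrow> real)"
    and Y\<^sub>0 :: "real \<Rightarrow> real"
  assumes "\<nu> > 0" and "\<gamma> > 0" and "\<delta> > 0" and "\<mu> > 0"
    and "is_partition N x" and "h = mesh_size N x" and "h > 0"
    and "interpolation_operator c\<^sub>p h I\<^sub>h"
    and "\<nu> \<ge> \<mu> * c\<^sub>p\<^sup>2 * h\<^sup>2 / 2"
    and "\<mu> \<ge> 2 * (\<gamma> + \<nu>)"
    and "Y\<^sub>0 \<in> fe_space N x"
    and "k > 0"
    and "k * (\<gamma> + \<mu> * c\<^sub>p\<^sup>2 * h\<^sup>2 / 2) < 1"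
  shows "\<exists>Y \<in> fe_space N x. \<forall>\<eta> \<in> fe_space N x.
    L2_inner (\<lambda>s. (Y s - Y\<^sub>0 s) / k) \<eta>
      + \<nu> * L2_inner (weak_deriv Y) (weak_deriv \<eta>)
      - \<gamma> * L2_inner Y \<eta>
      + \<delta> * L2_inner (\<lambda>s. (Y s) ^ 3) \<eta>
    = - \<mu> * L2_inner (I\<^sub>h Y) \<eta>"
proof -
  interpret mesh N x
    by unfold_locales fact
  have Y\<^sub>0: "Y\<^sub>0 \<in> L2"
    using assms(11) by (intro L2_continuous_on) (simp add: fe_space_def)
  obtain y where y: "\<And>w. (1 / k - \<gamma>) * L2_inner (pl y) (pl w) + \<nu> * L2_inner (pc y) (pc w)
      + \<mu> * L2_inner (I\<^sub>h (pl y)) (pl w) + \<delta> * L2_inner (\<lambda>s. (pl y s) ^ 3) (pl w)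
      - L2_inner Y\<^sub>0 (pl w) / k = 0"
    using scheme_slope_solution[OF assms(8) _ assms(4,12,9,13) Y\<^sub>0, of \<delta>] assms(3) by auto
  show ?thesis
  proof (intro bexI[of _ "pl y"] ballI pl_fe_space)
    fix \<eta> assume "\<eta> \<in> fe_space N x"
    then obtain w where w: "\<And>s. s \<in> {0..1} \<Longrightarrow> \<eta> s = pl w s"
      using fe_space_eq_pl by blast
    \<comment> \<open>A test function agrees with some \<open>pl w\<close> only on the closed unit
      interval, which is all that the inner products see.\<close>
    have \<eta>: "L2_inner f \<eta> = L2_inner f (pl w)" for f
      using w by (intro L2_inner_cong) auto
    have "L2_inner (weak_deriv (pl y)) (weak_deriv \<eta>) = L2_inner (pc y) (pc w)"
      using weak_deriv_AE_pc[of "pl y" y] weak_deriv_AE_pc[of \<eta> w] w L2_pc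
      by (intro L2_inner_cong_AE) (auto intro: L2_borel_measurable)
    moreover have "L2_inner (\<lambda>s. (pl y s - Y\<^sub>0 s) / k) (pl w)
        = (L2_inner (pl y) (pl w) - L2_inner Y\<^sub>0 (pl w)) / k"
      by (simp add: L2_inner_divide L2_inner_diff[OF L2_pl Y\<^sub>0 L2_pl])
    ultimately show "L2_inner (\<lambda>s. (pl y s - Y\<^sub>0 s) / k) \<eta>
      + \<nu> * L2_inner (weak_deriv (pl y)) (weak_deriv \<eta>)
      - \<gamma> * L2_inner (pl y) \<eta>
      + \<delta> * L2_inner (\<lambda>s. (pl y s) ^ 3) \<eta>
    = - \<mu> * L2_inner (I\<^sub>h (pl y)) \<eta>"
      using y[of w] by (simp add: \<eta> diff_divide_distrib algebra_simps)
  qed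
qed

end
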